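(* For any signature $\varepsilon=\varepsilon_1\cdots\varepsilon_n\in\{-,+\}^n$ and any $k\ge0$, the Cambrian $(k,\varepsilon)$-twist congruence $\equiv^k_\varepsilon$ is a lattice congruence of the weak order on $\mathfrak S_n$.
   Context: Each value $i\in[n]$ of a permutation carries the sign $\varepsilon_i$. The Cambrian $(k,\varepsilon)$-twist congruence $\equiv^k_\varepsilon$ on $\mathfrak S_n$ (permutations written as words) is the transitive closure of the rewriting rule $U\,a\,c\,V\equiv^k_\varepsilon U\,c\,a\,V$, where $a<c$ are elements of $[n]$ and $U,V$ are (possibly empty) words on $[n]$, whenever there exist $a<a'<c'<c$ such that either $|\{u\in U: a'\le u\le c',\ \varepsilon_u=+\}|-|\{v\in V: a'\le v\le c',\ \varepsilon_v=-\}|\ge k$ or $|\{v\in V: a'\le v\le c',\ \varepsilon_v=-\}|-|\{u\in U: a'\le u\le c',\ \varepsilon_u=+\}|\ge k$. The weak order on $\mathfrak S_n$: $\tau\le\tau'$ iff every coinversion of $\tau$ (pair $i<j$ with $\tau^{-1}(i)>\tau^{-1}(j)$) is a coinversion of $\tau'$. An equivalence relation on a lattice is a lattice congruence if its classes are intervals and the maps sending each element to the minimum (resp. maximum) of its class are order preserving (equivalently, it is compatible with meets and joins). *)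

theory Defs
  imports "HOL-Algebra.Lattice" "HOL-Combinatorics.Permutations"
begin

definition coinversions :: "nat \<Rightarrow> (nat \<Rightarrow> nat) \<Rightarrow> (nat \<times> nat) set" where
  "coinversions n \<tau> =
     {(i, j). i \<in> {1..n} \<and> j \<in> {1..n} \<and> i < j \<and> inv \<tau> i > inv \<tau> j}"

definition weak_order :: "nat \<Rightarrow> (nat \<Rightarrow> nat) gorder" where
  "weak_order n =
     \<lparr>carrier = {\<tau>. \<tau> permutes {1..n}}, eq = (=),
      le = (\<lambda>\<tau> \<tau>'. coinversions n \<tau> \<subseteq> coinversions n \<tau>')\<rparr>"

definition class_min :: "('a, 'b) gorder_scheme \<Rightarrow> ('a \<times> 'a) set \<Rightarrow> 'a \<Rightarrow> 'a" where
  "class_min L R x = (THE m. least L m (R `` {x}))"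

definition class_max :: "('a, 'b) gorder_scheme \<Rightarrow> ('a \<times> 'a) set \<Rightarrow> 'a \<Rightarrow> 'a" where
  "class_max L R x = (THE m. greatest L m (R `` {x}))"

definition lattice_congruence :: "('a, 'b) gorder_scheme \<Rightarrow> ('a \<times> 'a) set \<Rightarrow> bool" where
  "lattice_congruence L R \<longleftrightarrow>
     lattice L \<and> equiv (carrier L) R \<and>
     (\<forall>C \<in> carrier L // R. \<exists>l \<in> carrier L. \<exists>u \<in> carrier L. C = \<lbrace>l..u\<rbrace>\<^bsub>L\<^esub>) \<and>
     isotone L L (class_min L R) \<and> isotone L L (class_max L R)"

datatype sign = Minus | Plus

definition word :: "nat \<Rightarrow> (nat \<Rightarrow> nat) \<Rightarrow> nat list" where
  "word n \<tau> = map \<tau> [1..<Suc n]"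

definition sign_count :: "(nat \<Rightarrow> sign) \<Rightarrow> sign \<Rightarrow> nat \<Rightarrow> nat \<Rightarrow> nat list \<Rightarrow> nat" where
  "sign_count \<epsilon> s a' c' W = card {w \<in> set W. a' \<le> w \<and> w \<le> c' \<and> \<epsilon> w = s}"

definition twist_step ::
  "nat \<Rightarrow> (nat \<Rightarrow> sign) \<Rightarrow> nat \<Rightarrow> (nat \<Rightarrow> nat) \<Rightarrow> (nat \<Rightarrow> nat) \<Rightarrow> bool" where
  "twist_step n \<epsilon> k \<sigma> \<tau> \<longleftrightarrow>
     \<sigma> permutes {1..n} \<and> \<tau> permutes {1..n} \<and>
     (\<exists>U a c V. word n \<sigma> = U @ [a, c] @ V \<and> word n \<tau> = U @ [c, a] @ V \<and> a < c \<and>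
        (\<exists>a' c'. a < a' \<and> a' < c' \<and> c' < c \<and>
           (int (sign_count \<epsilon> Plus a' c' U) - int (sign_count \<epsilon> Minus a' c' V) \<ge> int k \<or>
            int (sign_count \<epsilon> Minus a' c' V) - int (sign_count \<epsilon> Plus a' c' U) \<ge> int k)))"

text \<open>The rewriting rule is read as an unoriented relation, so its closure is the generated
  equivalence relation.\<close>

definition twist_congruence ::
  "nat \<Rightarrow> (nat \<Rightarrow> sign) \<Rightarrow> nat \<Rightarrow> ((nat \<Rightarrow> nat) \<times> (nat \<Rightarrow> nat)) set" where
  "twist_congruence n \<epsilon> k =
     {(\<sigma>, \<tau>). \<sigma> permutes {1..n} \<and> \<tau> permutes {1..n} \<and> equivclp (twist_step n \<epsilon> k) \<sigma> \<tau>}"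

end

theory Submission
  imports Defs
begin

text \<open>
  Whether the rule may exchange adjacent values \<open>a < c\<close> depends only on the arc formed by \<open>a\<close>, \<open>c\<close>
  and the set of values strictly between them that stand in front, and the admissible arcs are
  closed under extension to a longer interval. Every such family of arcs yields a lattice
  congruence (a theorem of Reading). Indeed, call the corresponding cover relations of the weak
  order contracted. If \<open>x\<close> and \<open>y\<close> are lower covers of \<open>z\<close> and \<open>y < z\<close> is contracted, then closure
  under extension contracts, in the square or hexagon below \<open>z\<close>, the whole path from \<open>x\<close> down to
  the bottom. By induction on \<open>z\<close>, following contracted covers downwards ends in a unique normal
  form which is monotone in the starting point. The same holds upwards, and a class is
  the interval between its two normal forms.
\<close>

section \<open>Contracting edges of a poset\<close>

text \<open>\<open>S x y\<close> says that \<open>x\<close> is a lower cover of \<open>y\<close>, and \<open>E\<close> is the set of contracted covers. The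
  axiom \<open>polygon\<close> is the forcing condition in the polygon spanned by two lower covers of \<open>z\<close>.\<close>

locale lower_contraction =
  fixes X :: "'a set" and le S E :: "'a \<Rightarrow> 'a \<Rightarrow> bool" and rk :: "'a \<Rightarrow> nat"
  assumes le_refl: "le x x"
    and le_trans: "le x y \<Longrightarrow> le y z \<Longrightarrow> le x z"
    and le_antisym: "x \<in> X \<Longrightarrow> y \<in> X \<Longrightarrow> le x y \<Longrightarrow> le y x \<Longrightarrow> x = y"
    and contracted_cover: "E x y \<Longrightarrow> S x y"
    and cover_carrier: "S x y \<Longrightarrow> x \<in> X \<and> y \<in> X"
    and cover_le: "S x y \<Longrightarrow> le x y"
    and cover_rk: "S x y \<Longrightarrow> rk x < rk y"
    and cover_exists: "x \<in> X \<Longrightarrow> y \<in> X \<Longrightarrow> le x y \<Longrightarrow> x \<noteq> y \<Longrightarrow> \<exists>z. S z y \<and> le x z"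
    and polygon: "S x z \<Longrightarrow> E y z \<Longrightarrow> x \<noteq> y \<Longrightarrow> \<exists>w. E\<^sup>*\<^sup>* w x \<and> le w y"
begin

definition normal_form :: "'a \<Rightarrow> 'a \<Rightarrow> bool" where
  "normal_form x a \<longleftrightarrow> E\<^sup>*\<^sup>* a x \<and> (\<nexists>y. E y a)"

lemma path_le: "E\<^sup>*\<^sup>* x y \<Longrightarrow> le x y"
  by (induction rule: rtranclp_induct)
    (auto intro: le_refl le_trans cover_le contracted_cover)

lemma path_carrier: "E\<^sup>*\<^sup>* x y \<Longrightarrow> y \<in> X \<Longrightarrow> x \<in> X"
  by (induction rule: converse_rtranclp_induct) (auto dest: contracted_cover cover_carrier)

lemma normal_form_exists: "\<exists>a. normal_form x a"
proof (induction "rk x" arbitrary: x rule: less_induct)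
  case less
  show ?case
  proof (cases "\<exists>y. E y x")
    case True
    then obtain y where y: "E y x" by blast
    then obtain a where "normal_form y a"
      using less cover_rk contracted_cover by blast
    then show ?thesis
      using y unfolding normal_form_def by (meson rtranclp.rtrancl_into_rtrancl)
  qed (auto simp: normal_form_def)
qed

text \<open>The case \<open>x = z\<close> is included: it gives uniqueness of normal forms, so that no separate
  confluence argument is needed.\<close>

lemma normal_form_mono:
  assumes "x \<in> X" "z \<in> X" "le x z" "normal_form x a" "normal_form z b"
  shows "le a b"
  using assms
proof (induction "rk z" arbitrary: x z a b rule: less_induct)
  case (less z x a b)
  \<comment> \<open>Stated for an arbitrary element strictly below \<open>z\<close>, because it
    serves twice: for the given \<open>x\<close>, and for a contracted lower cover of
    \<open>z\<close> when \<open>x = z\<close>.\<close>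
  have strict: "le a b" if x: "x \<in> X" "le x z" "x \<noteq> z" "normal_form x a" for x
  proof (cases "b = z")
    case True
    then show ?thesis
      using x path_le le_trans unfolding normal_form_def by blast
  next
    case False
    then obtain y where y: "E\<^sup>*\<^sup>* b y" "E y z"
      using less.prems(5) unfolding normal_form_def by (metis rtranclp.cases)
    have yb: "normal_form y b"
      using y less.prems(5) by (simp add: normal_form_def)
    have yX: "y \<in> X" "rk y < rk z"
      using y contracted_cover cover_carrier cover_rk by blast+
    obtain x1 where x1: "S x1 z" "le x x1"
      using cover_exists x less.prems by blast
    have x1X: "x1 \<in> X" "rk x1 < rk z"
      using x1 cover_carrier cover_rk by blast+
    show ?thesis
    proof (cases "x1 = y")
      case True
      then show ?thesis
        using less.hyps[of y x a b] yX x x1 yb by blast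
    next
      case False
      \<comment> \<open>The bottom \<open>w\<close> of the polygon links the two lower covers. It is
        reached from \<open>x1\<close> by contracted covers, so a normal form \<open>d\<close> of
        \<open>w\<close> is one of \<open>x1\<close> too. Induction at \<open>x1\<close> gives
        \<open>le a d\<close>, and induction at \<open>y\<close> gives
        \<open>le d b\<close>.\<close>
      then obtain w where w: "E\<^sup>*\<^sup>* w x1" "le w y"
        using polygon x1 y by blast
      obtain d where d: "normal_form w d"
        using normal_form_exists by blast
      then have "normal_form x1 d"
        using w unfolding normal_form_def by auto
      then have "le a d"
        using less.hyps[of x1 x a d] x1 x1X x by blast
      moreover have "le d b"
        using less.hyps[of y w d b] yX w d yb path_carrier x1X by blast
      ultimately show ?thesis
        using le_trans by blast
    qed
  qed
  show ?case
  proof (cases "x = z")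
    case False
    then show ?thesis
      using strict less.prems by blast
  next
    case True
    show ?thesis
    proof (cases "a = z")
      case True
      then have "b = z"
        using less.prems \<open>x = z\<close> unfolding normal_form_def by (metis rtranclp.cases)
      then show ?thesis
        using True le_refl by simp
    next
      case False
      \<comment> \<open>The descent from \<open>z\<close> to \<open>a\<close> starts with a
        contracted cover \<open>y\<close> of \<open>z\<close>. Since \<open>a\<close> is also a
        normal form of \<open>y\<close>, the strict case applies to \<open>y\<close>.\<close>
      then obtain y where y: "E\<^sup>*\<^sup>* a y" "E y z"
        using less.prems(4) \<open>x = z\<close> unfolding normal_form_def by (metis rtranclp.cases)
      have "normal_form y a"
        using y less.prems(4) by (simp add: normal_form_def)
      moreover have "y \<in> X" "le y z" "y \<noteq> z"
        using y contracted_cover cover_carrier cover_le cover_rk by blast+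
      ultimately show ?thesis
        using strict by blast
    qed
  qed
qed

section \<open>Projection to the normal form\<close>

text \<open>The choice by \<open>SOME\<close> is determined: on \<open>X\<close> normal forms are
  unique by \<open>normal_form_mono\<close> with \<open>x = z\<close>, and outside \<open>X\<close>
  there are no covers, so each element is its own normal form.\<close>

definition proj :: "'a \<Rightarrow> 'a" where
  "proj x = (SOME a. normal_form x a)"

lemma normal_form_proj: "normal_form x (proj x)"
  unfolding proj_def using normal_form_exists by (rule someI_ex)

lemma proj_path: "E\<^sup>*\<^sup>* (proj x) x"
  using normal_form_proj by (simp add: normal_form_def)

lemma proj_carrier: "x \<in> X \<Longrightarrow> proj x \<in> X"
  using proj_path path_carrier by blast

lemma proj_le: "le (proj x) x"
  using proj_path path_le by blast

lemma proj_mono: "x \<in> X \<Longrightarrow> y \<in> X \<Longrightarrow> le x y \<Longrightarrow> le (proj x) (proj y)"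
  using normal_form_mono normal_form_proj by blast

text \<open>One more contracted cover leads from \<open>y\<close> down to \<open>x\<close>, so the
  normal form of \<open>x\<close> is a normal form of \<open>y\<close> as well, and uniqueness
  applies.\<close>

lemma proj_contracted:
  assumes "E x y"
  shows "proj x = proj y"
proof -
  have X: "x \<in> X" "y \<in> X" "le x y"
    using assms contracted_cover cover_carrier cover_le by blast+
  have "normal_form y (proj x)"
    using assms normal_form_proj[of x] unfolding normal_form_def by auto
  then have "le (proj y) (proj x)"
    using normal_form_mono[OF X(2,2) le_refl normal_form_proj] by blast
  then show ?thesis
    using le_antisym[OF proj_carrier proj_carrier] proj_mono X by metis
qed

lemma equivclp_proj: "equivclp E (proj x) x"
  by (rule rtranclp_into_equivclp) (rule proj_path)

text \<open>The projection is constant along contracted covers, and every element is joined to its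
  projection by such covers. Hence the fibres of \<open>proj\<close> are exactly the
  classes.\<close>

lemma equivclp_iff_proj: "equivclp E x y \<longleftrightarrow> proj x = proj y"
proof
  show "equivclp E x y \<Longrightarrow> proj x = proj y"
    by (induction rule: equivclp_induct) (auto dest: proj_contracted)
  show "proj x = proj y \<Longrightarrow> equivclp E x y"
    by (metis equivclp_proj equivclp_sym equivclp_trans)
qed

lemma proj_proj: "proj (proj x) = proj x"
  using equivclp_proj equivclp_iff_proj by blast

end

section \<open>From contracted covers to a lattice congruence\<close>

text \<open>The locale is used for the order and for its dual. The two projections are the minimum
  and the maximum of each class, and \<open>proj_mono\<close> makes both isotone.\<close>

theorem lattice_congruence_of_contraction:
  fixes L (structure)
  assumes L: "lattice L"
    and lo: "lower_contraction (carrier L) (le L) S E r"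
    and up: "lower_contraction (carrier L) (\<lambda>x y. le L y x) S\<inverse>\<inverse> E\<inverse>\<inverse> r'"
  shows "lattice_congruence L
    {(x, y). x \<in> carrier L \<and> y \<in> carrier L \<and> equivclp E x y}" (is "lattice_congruence L ?R")
proof -
  interpret lattice L by (rule L)
  interpret lo: lower_contraction "carrier L" "le L" S E r by (rule lo)
  interpret up: lower_contraction "carrier L" "\<lambda>x y. le L y x" "S\<inverse>\<inverse>" "E\<inverse>\<inverse>" r' by (rule up)
  \<comment> \<open>A relation and its converse generate the same equivalence, so both projections
    describe the same classes.\<close>
  note up_iff = up.equivclp_iff_proj[unfolded equivclp_conversep]
  note up_proj = up.equivclp_proj[unfolded equivclp_conversep]
  have equiv: "equiv (carrier L) ?R"
  proof (rule equivI)
    show "sym ?R"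
      by (rule symI) (blast dest: equivclp_sym)
    show "trans ?R"
      by (rule transI) (blast dest: equivclp_trans)
  qed (auto simp: refl_on_def)
  have cls: "?R `` {x} = {y \<in> carrier L. equivclp E x y}" if "x \<in> carrier L" for x
    using that by auto
  have least: "least L (lo.proj x) (?R `` {x})" if x: "x \<in> carrier L" for x
    unfolding cls[OF x] least_def
  proof (intro conjI ballI)
    show "lo.proj x \<in> {y \<in> carrier L. equivclp E x y}"
      using lo.proj_carrier[OF x] equivclp_sym[OF lo.equivclp_proj] by blast
    show "lo.proj x \<sqsubseteq> y" if "y \<in> {y \<in> carrier L. equivclp E x y}" for y
      using that lo.proj_le[of y] by (simp add: lo.equivclp_iff_proj)
  qed blast
  have greatest: "greatest L (up.proj x) (?R `` {x})" if x: "x \<in> carrier L" for x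
    unfolding cls[OF x] greatest_def
  proof (intro conjI ballI)
    show "up.proj x \<in> {y \<in> carrier L. equivclp E x y}"
      using up.proj_carrier[OF x] equivclp_sym[OF up_proj] by blast
    show "y \<sqsubseteq> up.proj x" if "y \<in> {y \<in> carrier L. equivclp E x y}" for y
      using that up.proj_le[of y] by (simp add: up_iff)
  qed blast
  have cmin: "class_min L ?R x = lo.proj x" if x: "x \<in> carrier L" for x
    unfolding class_min_def
    by (rule the_equality) (use least[OF x] in \<open>auto simp: least_def\<close>)
  have cmax: "class_max L ?R x = up.proj x" if x: "x \<in> carrier L" for x
    unfolding class_max_def
    by (rule the_equality) (use greatest[OF x] in \<open>auto simp: greatest_def\<close>)
  have interval: "?R `` {x} = \<lbrace>lo.proj x..up.proj x\<rbrace>" if x: "x \<in> carrier L" for x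
  proof (intro equalityI subsetI)
    fix y assume "y \<in> ?R `` {x}"
    then show "y \<in> \<lbrace>lo.proj x..up.proj x\<rbrace>"
      using least[OF x] greatest[OF x]
      unfolding least_def greatest_def at_least_at_most_def by blast
  next
    fix y assume "y \<in> \<lbrace>lo.proj x..up.proj x\<rbrace>"
    then have y: "y \<in> carrier L" "lo.proj x \<sqsubseteq> y" "y \<sqsubseteq> up.proj x"
      by (auto simp: at_least_at_most_def)
    \<comment> \<open>The top of the class has the same lower projection as \<open>x\<close>, and so
      has the bottom. Monotonicity of \<open>lo.proj\<close> then squeezes \<open>lo.proj y\<close>
      between two copies of \<open>lo.proj x\<close>.\<close>
    have "lo.proj (up.proj x) = lo.proj x"
      using up_proj[of x] lo.equivclp_iff_proj by blast
    then have "lo.proj y \<sqsubseteq> lo.proj x" "lo.proj x \<sqsubseteq> lo.proj y"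
      using lo.proj_mono[of y "up.proj x"] lo.proj_mono[of "lo.proj x" y] y x
        up.proj_carrier lo.proj_carrier lo.proj_proj by auto
    then have "lo.proj x = lo.proj y"
      using le_antisym[OF _ _ lo.proj_carrier lo.proj_carrier] x y by metis
    then show "y \<in> ?R `` {x}"
      using x y lo.equivclp_iff_proj by auto
  qed
  have intervals: "\<exists>l\<in>carrier L. \<exists>u\<in>carrier L. C = \<lbrace>l..u\<rbrace>" if C: "C \<in> carrier L // ?R" for C
  proof -
    obtain x where "x \<in> carrier L" "C = ?R `` {x}"
      using C by (auto elim: quotientE)
    then show ?thesis
      using interval lo.proj_carrier up.proj_carrier by blast
  qed
  have mono_min: "isotone L L (class_min L ?R)"
    by (rule isotoneI) (simp_all add: cmin lo.proj_mono weak_partial_order_axioms)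
  have mono_max: "isotone L L (class_max L ?R)"
    by (rule isotoneI) (simp_all add: cmax up.proj_mono weak_partial_order_axioms)
  show ?thesis
    unfolding lattice_congruence_def
    by (intro conjI ballI L equiv intervals mono_min mono_max)
qed

section \<open>The weak order\<close>

definition pairs :: "nat \<Rightarrow> (nat \<times> nat) set" where
  "pairs n = {(i, j). 1 \<le> i \<and> i < j \<and> j \<le> n}"

text \<open>With \<open>(i, j)\<close> read as the root \<open>e_i - e_j\<close>, these are the
  biclosed sets of positive roots of type A. They are exactly the coinversion sets, so joins and
  meets can be built from sets of pairs.\<close>

definition biclosed :: "nat \<Rightarrow> (nat \<times> nat) set \<Rightarrow> bool" where
  "biclosed n J \<longleftrightarrow> J \<subseteq> pairs n \<and> trans J \<and>
     (\<forall>a b c. (a, c) \<in> J \<longrightarrow> a < b \<longrightarrow> b < c \<longrightarrow> (a, b) \<in> J \<or> (b, c) \<in> J)"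

lemma finite_pairs: "finite (pairs n)"
  by (rule finite_subset[of _ "{1..n} \<times> {1..n}"]) (auto simp: pairs_def)

lemma coinversions_subset: "coinversions n \<tau> \<subseteq> pairs n"
  by (auto simp: coinversions_def pairs_def)

lemma finite_coinversions: "finite (coinversions n \<tau>)"
  using coinversions_subset finite_pairs by (rule finite_subset)

lemma mem_coinversions:
  "(a, b) \<in> coinversions n \<tau> \<longleftrightarrow> (a, b) \<in> pairs n \<and> inv \<tau> b < inv \<tau> a"
  by (auto simp: coinversions_def pairs_def)

lemma biclosed_coinversions: "biclosed n (coinversions n \<tau>)"
  unfolding biclosed_def
proof (intro conjI coinversions_subset allI impI transI)
  fix a b c
  show "(a, c) \<in> coinversions n \<tau>"
    if "(a, b) \<in> coinversions n \<tau>" "(b, c) \<in> coinversions n \<tau>"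
    using that by (auto simp: coinversions_def)
  show "(a, b) \<in> coinversions n \<tau> \<or> (b, c) \<in> coinversions n \<tau>"
    if "(a, c) \<in> coinversions n \<tau>" "a < b" "b < c"
    using that by (auto simp: coinversions_def)
qed

text \<open>Complementation in \<open>pairs n\<close> exchanges the two closure conditions. This is
  the duality that turns joins into meets.\<close>

lemma biclosed_complement:
  assumes "biclosed n J"
  shows "biclosed n (pairs n - J)"
  unfolding biclosed_def
proof (intro conjI allI impI transI)
  fix a b c
  show "(a, c) \<in> pairs n - J" if "(a, b) \<in> pairs n - J" "(b, c) \<in> pairs n - J"
  proof -
    have "(a, c) \<in> pairs n" "a < b" "b < c"
      using that by (auto simp: pairs_def)
    then show ?thesis
      using assms that unfolding biclosed_def by blast
  qed
  show "(a, b) \<in> pairs n - J \<or> (b, c) \<in> pairs n - J"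
    if "(a, c) \<in> pairs n - J" "a < b" "b < c"
  proof -
    have "(a, b) \<in> pairs n" "(b, c) \<in> pairs n"
      using that by (auto simp: pairs_def)
    then show ?thesis
      using assms that unfolding biclosed_def by (meson DiffE DiffI transD)
  qed
qed auto

lemma trans_pairs: "trans (pairs n)"
  by (rule transI) (auto simp: pairs_def)

text \<open>A chain from \<open>a\<close> to \<open>c\<close> is increasing, so an intermediate
  \<open>b\<close> is either a vertex of the chain or lies strictly inside one link. That link
  belongs to \<open>I\<close> or \<open>J\<close> and is split at \<open>b\<close> by the second
  closure condition, and one of the two parts completes to a chain ending or starting at
  \<open>b\<close>.\<close>

lemma biclosed_trancl_Un:
  assumes I: "biclosed n I" and J: "biclosed n J"
  shows "biclosed n ((I \<union> J)\<^sup>+)"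
  unfolding biclosed_def
proof (intro conjI allI impI)
  have "(I \<union> J)\<^sup>+ \<subseteq> (pairs n)\<^sup>+"
    by (intro trancl_mono_subset Un_least) (use I J in \<open>auto simp: biclosed_def\<close>)
  then show "(I \<union> J)\<^sup>+ \<subseteq> pairs n"
    using trans_pairs by (simp add: trancl_id)
  fix a b c
  assume ac: "(a, c) \<in> (I \<union> J)\<^sup>+" and "a < b" "b < c"
  then show "(a, b) \<in> (I \<union> J)\<^sup>+ \<or> (b, c) \<in> (I \<union> J)\<^sup>+"
  proof (induction rule: trancl_induct)
    case (base y)
    then have "(a, b) \<in> I \<union> J \<or> (b, y) \<in> I \<union> J"
      using I J unfolding biclosed_def by blast
    then show ?case by blast
  next
    case (step y z)
    consider "b < y" | "b = y" | "y < b" by linarith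
    then show ?case
    proof cases
      case 1
      then show ?thesis
        using step by (meson trancl.trancl_into_trancl)
    next
      case 2
      then show ?thesis
        using step by blast
    next
      case 3
      then have "(y, b) \<in> I \<union> J \<or> (b, z) \<in> I \<union> J"
        using I J step unfolding biclosed_def by blast
      then show ?thesis
        using step by (meson r_into_trancl trancl.trancl_into_trancl)
    qed
  qed
qed (rule trans_trancl)

text \<open>Reversing the natural order on precisely the pairs in \<open>J\<close> gives a strict
  total order when \<open>J\<close> is biclosed. Listing \<open>1..n\<close> in this order gives the
  permutation.\<close>

lemma biclosed_is_coinversions:
  assumes J: "biclosed n J"
  obtains \<tau> where "\<tau> permutes {1..n}" "coinversions n \<tau> = J"
proof -
  \<comment> \<open>\<open>before x y\<close> prescribes that the value \<open>x\<close> stands to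
    the left of \<open>y\<close> in the word.\<close>
  define before where "before x y \<longleftrightarrow> (x < y \<and> (x, y) \<notin> J) \<or> (y < x \<and> (y, x) \<in> J)"
    for x y
  \<comment> \<open>The rank of \<open>x\<close> counts \<open>x\<close> itself, so that ranks run
    from \<open>1\<close> to \<open>n\<close>. Outside this range \<open>p\<close> is the identity,
    as \<open>permutes\<close> demands.\<close>
  define p where "p x = (if x \<in> {1..n} then card {y \<in> {1..n}. before y x \<or> y = x} else x)" for x
  have pairs: "(x, y) \<in> pairs n \<longleftrightarrow> x \<in> {1..n} \<and> y \<in> {1..n} \<and> x < y" for x y
    by (auto simp: pairs_def)
  have tr: "(a, c) \<in> J" if "(a, b) \<in> J" "(b, c) \<in> J" for a b c
    using J that unfolding biclosed_def by (meson transD)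
  have ctr: "(a, b) \<in> J \<or> (b, c) \<in> J" if "(a, c) \<in> J" "a < b" "b < c" for a b c
    using J that unfolding biclosed_def by blast
  \<comment> \<open>Two natural steps use the splitting condition on \<open>J\<close>, two reversed
    steps use transitivity. In the mixed cases the order of \<open>x\<close> and \<open>z\<close> is
    open, and both conditions are used.\<close>
  have btrans: "before x z" if "before x y" "before y z" for x y z
    using that unfolding before_def
  proof (elim disjE conjE)
    assume "x < y" "(x, y) \<notin> J" "y < z" "(y, z) \<notin> J"
    then show "x < z \<and> (x, z) \<notin> J \<or> z < x \<and> (z, x) \<in> J"
      using ctr[of x z y] by auto
  next
    assume "x < y" "(x, y) \<notin> J" "z < y" "(z, y) \<in> J"
    then show "x < z \<and> (x, z) \<notin> J \<or> z < x \<and> (z, x) \<in> J"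
      using ctr[of z y x] tr[of x z y] by (cases x z rule: linorder_cases) auto
  next
    assume "y < x" "(y, x) \<in> J" "y < z" "(y, z) \<notin> J"
    then show "x < z \<and> (x, z) \<notin> J \<or> z < x \<and> (z, x) \<in> J"
      using ctr[of y x z] tr[of y x z] by (cases x z rule: linorder_cases) auto
  next
    assume "y < x" "(y, x) \<in> J" "z < y" "(z, y) \<in> J"
    then show "x < z \<and> (x, z) \<notin> J \<or> z < x \<and> (z, x) \<in> J"
      using tr[of z y x] by auto
  qed
  have total: "before x y \<or> before y x" if "x \<noteq> y" for x y
    using that unfolding before_def by auto
  have irrefl: "\<not> before x x" for x
    by (auto simp: before_def)
  have p_less: "p x < p y" if "before x y" "x \<in> {1..n}" "y \<in> {1..n}" for x y
  proof -
    have "{z \<in> {1..n}. before z x \<or> z = x} \<subset> {z \<in> {1..n}. before z y \<or> z = y}"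
      using that btrans irrefl by blast
    then have "card {z \<in> {1..n}. before z x \<or> z = x} < card {z \<in> {1..n}. before z y \<or> z = y}"
      by (intro psubset_card_mono) auto
    then show ?thesis
      using that by (simp add: p_def)
  qed
  have p_iff: "p x < p y \<longleftrightarrow> before x y" if "x \<in> {1..n}" "y \<in> {1..n}" for x y
    using p_less[of x y] p_less[of y x] total[of x y] that
    by (metis less_asym less_irrefl)
  have "inj_on p {1..n}"
    using p_less total by (metis inj_onI less_irrefl)
  moreover have "p ` {1..n} \<subseteq> {1..n}"
  proof safe
    fix x assume x: "x \<in> {1..n}"
    let ?A = "{y \<in> {1..n}. before y x \<or> y = x}"
    have "x \<in> ?A" "finite ?A"
      using x by auto
    then have "card ?A > 0"
      by (auto simp: card_gt_0_iff)
    moreover have "card ?A \<le> card {1..n}"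
      by (rule card_mono) auto
    ultimately show "p x \<in> {1..n}"
      using x by (auto simp: p_def)
  qed
  ultimately have "bij_betw p {1..n} {1..n}"
    by (simp add: bij_betw_def endo_inj_surj)
  then have p: "p permutes {1..n}"
    by (rule bij_imp_permutes) (auto simp: p_def)
  \<comment> \<open>\<open>p\<close> sends a value to its position, so the permutation with the
    prescribed word is \<open>inv p\<close>.\<close>
  have "(a, b) \<in> coinversions n (inv p) \<longleftrightarrow> (a, b) \<in> J" for a b
  proof -
    have "(a, b) \<in> coinversions n (inv p) \<longleftrightarrow> (a, b) \<in> pairs n \<and> before b a"
      using p_iff by (auto simp: mem_coinversions pairs permutes_inv_inv[OF p])
    also have "\<dots> \<longleftrightarrow> (a, b) \<in> J"
      using J by (auto simp: before_def biclosed_def pairs)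
    finally show ?thesis .
  qed
  then have "coinversions n (inv p) = J"
    by auto
  then show thesis
    using that permutes_inv[OF p] by blast
qed

section \<open>Adjacent transpositions and covers of the weak order\<close>

text \<open>Composed on the right, as in \<open>\<sigma> \<circ> adj i\<close>, it exchanges the
  entries at positions \<open>i\<close> and \<open>Suc i\<close> of the word, not the values
  \<open>i\<close> and \<open>Suc i\<close>.\<close>

definition adj :: "nat \<Rightarrow> nat \<Rightarrow> nat" where
  "adj i = Transposition.transpose i (Suc i)"

lemma adj_simps [simp]:
  "adj i i = Suc i" "adj i (Suc i) = i" "j \<noteq> i \<Longrightarrow> j \<noteq> Suc i \<Longrightarrow> adj i j = j"
  by (simp_all add: adj_def)

lemma adj_adj [simp]: "adj i (adj i j) = j"
  by (simp add: adj_def)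

lemma comp_adj_adj [simp]: "\<sigma> \<circ> adj i \<circ> adj i = \<sigma>"
  by (simp add: fun_eq_iff)

lemma adj_permutes: "i \<in> {1..<n} \<Longrightarrow> adj i permutes {1..n}"
  unfolding adj_def by (rule permutes_swap_id) auto

lemma comp_adj_permutes:
  "\<sigma> permutes {1..n} \<Longrightarrow> i \<in> {1..<n} \<Longrightarrow> \<sigma> \<circ> adj i permutes {1..n}"
  by (intro permutes_compose adj_permutes)

lemmas comp_adj_permutes' [simp] = comp_adj_permutes [simplified]

lemma adj_less_iff:
  assumes "x \<noteq> y" "{x, y} \<noteq> {i, Suc i}"
  shows "adj i x < adj i y \<longleftrightarrow> x < y"
  using assms by (auto simp: adj_def Transposition.transpose_def)

text \<open>Only the positions \<open>i\<close> and \<open>Suc i\<close> change their relative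
  order, so every other pair of values keeps its status.\<close>

lemma coinversions_comp_adj:
  assumes \<sigma>: "\<sigma> permutes {1..n}" and i: "i \<in> {1..<n}" and asc: "\<sigma> i < \<sigma> (Suc i)"
  shows "coinversions n (\<sigma> \<circ> adj i) = insert (\<sigma> i, \<sigma> (Suc i)) (coinversions n \<sigma>)"
    and "(\<sigma> i, \<sigma> (Suc i)) \<notin> coinversions n \<sigma>"
proof -
  note inv = permutes_inverses[OF \<sigma>]
  have bij: "bij \<sigma>" "bij (adj i)"
    using \<sigma> adj_permutes[OF i] permutes_bij by auto
  have "inv (adj i) = adj i"
    by (rule inv_equality) auto
  then have inv': "inv (\<sigma> \<circ> adj i) x = adj i (inv \<sigma> x)" for x
    using o_inv_distrib[OF bij] by simp
  have mem: "\<sigma> i \<in> {1..n}" "\<sigma> (Suc i) \<in> {1..n}"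
    using i permutes_in_image[OF \<sigma>] by auto
  show "(\<sigma> i, \<sigma> (Suc i)) \<notin> coinversions n \<sigma>"
    by (simp add: coinversions_def inv)
  have "(a, b) \<in> coinversions n (\<sigma> \<circ> adj i) \<longleftrightarrow>
      (a, b) = (\<sigma> i, \<sigma> (Suc i)) \<or> (a, b) \<in> coinversions n \<sigma>" for a b
  proof (cases "{inv \<sigma> a, inv \<sigma> b} = {i, Suc i}")
    case True
    then consider "inv \<sigma> a = i" "inv \<sigma> b = Suc i" | "inv \<sigma> a = Suc i" "inv \<sigma> b = i"
      by (auto simp: doubleton_eq_iff)
    then show ?thesis
    proof cases
      case 1
      then have "a = \<sigma> i" "b = \<sigma> (Suc i)"
        using inv by metis+
      then show ?thesis
        using mem asc by (simp add: coinversions_def inv inv')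
    next
      case 2
      then have "a = \<sigma> (Suc i)" "b = \<sigma> i"
        using inv by metis+
      then show ?thesis
        using mem asc by (simp add: coinversions_def inv inv')
    qed
  next
    case False
    then have ne: "(a, b) \<noteq> (\<sigma> i, \<sigma> (Suc i))"
      using inv by auto
    show ?thesis
    proof (cases "a = b")
      case True
      then show ?thesis
        using ne by (auto simp: coinversions_def)
    next
      case ab: False
      then have "inv \<sigma> b \<noteq> inv \<sigma> a"
        using inv by metis
      then have "adj i (inv \<sigma> b) < adj i (inv \<sigma> a) \<longleftrightarrow> inv \<sigma> b < inv \<sigma> a"
        using False by (intro adj_less_iff) auto
      then show ?thesis
        using ne by (auto simp: mem_coinversions inv')
    qed
  qed
  then show "coinversions n (\<sigma> \<circ> adj i) = insert (\<sigma> i, \<sigma> (Suc i)) (coinversions n \<sigma>)"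
    by auto
qed

text \<open>Counting up from \<open>1\<close>, strict increase forces \<open>i \<le> f i\<close>;
  counting down from \<open>n\<close>, it forces \<open>f i \<le> i\<close>.\<close>

lemma permutes_increasing_imp_id:
  assumes f: "f permutes {1..n}" and inc: "\<And>i. i \<in> {1..<n} \<Longrightarrow> f i < f (Suc i)"
  shows "f = id"
proof -
  have ge: "i \<le> f i" if "i \<le> n" for i
    using that
  proof (induction i)
    case (Suc i)
    then show ?case
    proof (cases "i = 0")
      case True
      then show ?thesis
        using permutes_in_image[OF f, of 1] Suc by auto
    next
      case False
      then show ?thesis
        using Suc inc[of i] by auto
    qed
  qed simp
  have le: "f (n - d) \<le> n - d" if "d < n" for d
    using that
  proof (induction d)
    case 0
    then show ?case
      using permutes_in_image[OF f, of n] by auto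
  next
    case (Suc d)
    have "f (n - Suc d) < f (Suc (n - Suc d))"
      using Suc.prems by (intro inc) auto
    then show ?case
      using Suc by (simp add: Suc_diff_Suc)
  qed
  have "f i = i" for i
  proof (cases "i \<in> {1..n}")
    case True
    then show ?thesis
      using ge[of i] le[of "n - i"] by auto
  next
    case False
    then show ?thesis
      using permutes_not_in[OF f] by blast
  qed
  then show ?thesis
    by auto
qed

text \<open>\<open>inv \<tau> \<circ> \<sigma>\<close> lists the positions in \<open>\<tau>\<close>
  of the consecutive entries of \<open>\<sigma>\<close>. Without a descent it would be the identity,
  and the two permutations would agree.\<close>

lemma exists_adjacent_difference:
  assumes \<sigma>: "\<sigma> permutes {1..n}" and \<tau>: "\<tau> permutes {1..n}" and "\<sigma> \<noteq> \<tau>"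
  obtains i where "i \<in> {1..<n}" "inv \<tau> (\<sigma> (Suc i)) < inv \<tau> (\<sigma> i)"
proof -
  have "inv \<tau> \<circ> \<sigma> \<noteq> id"
  proof
    assume "inv \<tau> \<circ> \<sigma> = id"
    then have "\<tau> \<circ> (inv \<tau> \<circ> \<sigma>) = \<tau>"
      by simp
    then show False
      using \<open>\<sigma> \<noteq> \<tau>\<close> permutes_inverses[OF \<tau>] by (simp add: fun_eq_iff)
  qed
  moreover have p: "inv \<tau> \<circ> \<sigma> permutes {1..n}"
    by (intro permutes_compose permutes_inv \<sigma> \<tau>)
  ultimately obtain i where i: "i \<in> {1..<n}" "\<not> (inv \<tau> \<circ> \<sigma>) i < (inv \<tau> \<circ> \<sigma>) (Suc i)"
    using permutes_increasing_imp_id by blast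
  moreover have "(inv \<tau> \<circ> \<sigma>) i \<noteq> (inv \<tau> \<circ> \<sigma>) (Suc i)"
    using permutes_inj[OF p] by (metis injD n_not_Suc_n)
  ultimately show thesis
    using that[of i] by simp
qed

text \<open>Take adjacent entries of \<open>\<tau>\<close> that \<open>\<sigma>\<close> has in the
  opposite order. If they ascended in \<open>\<tau>\<close>, they would form a coinversion of
  \<open>\<sigma>\<close> but not of \<open>\<tau>\<close>. So they descend, and swapping them only
  removes a pair that is no coinversion of \<open>\<sigma>\<close>.\<close>

lemma lower_cover_exists:
  assumes \<sigma>: "\<sigma> permutes {1..n}" and \<tau>: "\<tau> permutes {1..n}"
    and le: "coinversions n \<sigma> \<subseteq> coinversions n \<tau>" and "\<sigma> \<noteq> \<tau>"
  obtains i where "i \<in> {1..<n}" "\<tau> (Suc i) < \<tau> i"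
    "coinversions n \<sigma> \<subseteq> coinversions n (\<tau> \<circ> adj i)"
proof -
  obtain i where i: "i \<in> {1..<n}" "inv \<sigma> (\<tau> (Suc i)) < inv \<sigma> (\<tau> i)"
    using exists_adjacent_difference[OF \<tau> \<sigma>] \<open>\<sigma> \<noteq> \<tau>\<close> by metis
  have mem: "\<tau> i \<in> {1..n}" "\<tau> (Suc i) \<in> {1..n}"
    using i permutes_in_image[OF \<tau>] by auto
  have "\<tau> i \<noteq> \<tau> (Suc i)"
    using permutes_inj[OF \<tau>] by (metis injD n_not_Suc_n)
  moreover have "\<not> \<tau> i < \<tau> (Suc i)"
  proof
    assume "\<tau> i < \<tau> (Suc i)"
    then have "(\<tau> i, \<tau> (Suc i)) \<in> coinversions n \<sigma>"
      using i mem by (simp add: coinversions_def)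
    then have "(\<tau> i, \<tau> (Suc i)) \<in> coinversions n \<tau>"
      using le by blast
    then show False
      by (simp add: coinversions_def permutes_inverses[OF \<tau>])
  qed
  ultimately have desc: "\<tau> (Suc i) < \<tau> i"
    by simp
  \<comment> \<open>The swap lemma concerns ascents, so it is applied to
    \<open>\<tau> \<circ> adj i\<close>; a second swap restores \<open>\<tau>\<close>.\<close>
  have "coinversions n \<tau> = insert (\<tau> (Suc i), \<tau> i) (coinversions n (\<tau> \<circ> adj i))"
    using coinversions_comp_adj(1)[OF comp_adj_permutes[OF \<tau> i(1)] i(1)] desc by simp
  moreover have "(\<tau> (Suc i), \<tau> i) \<notin> coinversions n \<sigma>"
    using i by (auto simp: coinversions_def)
  ultimately have "coinversions n \<sigma> \<subseteq> coinversions n (\<tau> \<circ> adj i)"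
    using le by auto
  then show thesis
    by (rule that[OF i(1) desc])
qed

text \<open>Dually, adjacent entries of \<open>\<sigma>\<close> that \<open>\<tau>\<close> has in
  the opposite order must ascend in \<open>\<sigma>\<close>, and swapping them adds a pair that
  \<open>\<tau>\<close> already has.\<close>

lemma upper_cover_exists:
  assumes \<sigma>: "\<sigma> permutes {1..n}" and \<tau>: "\<tau> permutes {1..n}"
    and le: "coinversions n \<sigma> \<subseteq> coinversions n \<tau>" and "\<sigma> \<noteq> \<tau>"
  obtains i where "i \<in> {1..<n}" "\<sigma> i < \<sigma> (Suc i)"
    "coinversions n (\<sigma> \<circ> adj i) \<subseteq> coinversions n \<tau>"
proof -
  obtain i where i: "i \<in> {1..<n}" "inv \<tau> (\<sigma> (Suc i)) < inv \<tau> (\<sigma> i)"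
    using exists_adjacent_difference[OF \<sigma> \<tau>] \<open>\<sigma> \<noteq> \<tau>\<close> by metis
  have mem: "\<sigma> i \<in> {1..n}" "\<sigma> (Suc i) \<in> {1..n}"
    using i permutes_in_image[OF \<sigma>] by auto
  have "\<sigma> i \<noteq> \<sigma> (Suc i)"
    using permutes_inj[OF \<sigma>] by (metis injD n_not_Suc_n)
  moreover have "\<not> \<sigma> (Suc i) < \<sigma> i"
  proof
    assume "\<sigma> (Suc i) < \<sigma> i"
    then have "(\<sigma> (Suc i), \<sigma> i) \<in> coinversions n \<sigma>"
      using mem by (auto simp: coinversions_def permutes_inverses[OF \<sigma>])
    then have "(\<sigma> (Suc i), \<sigma> i) \<in> coinversions n \<tau>"
      using le by blast
    then show False
      using i by (simp add: coinversions_def)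
  qed
  ultimately have asc: "\<sigma> i < \<sigma> (Suc i)"
    by simp
  have "(\<sigma> i, \<sigma> (Suc i)) \<in> coinversions n \<tau>"
    using i mem asc by (auto simp: coinversions_def)
  then have "coinversions n (\<sigma> \<circ> adj i) \<subseteq> coinversions n \<tau>"
    unfolding coinversions_comp_adj(1)[OF \<sigma> i(1) asc] using le by simp
  then show thesis
    by (rule that[OF i(1) asc])
qed

text \<open>Otherwise some swap would add a new coinversion to \<open>\<sigma>\<close> and still
  stay below \<open>\<tau>\<close>, although both have the same coinversions. This is antisymmetry
  of the weak order.\<close>

lemma coinversions_inject:
  assumes \<sigma>: "\<sigma> permutes {1..n}" and \<tau>: "\<tau> permutes {1..n}"
    and eq: "coinversions n \<sigma> = coinversions n \<tau>"
  shows "\<sigma> = \<tau>"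
proof (rule ccontr)
  assume "\<sigma> \<noteq> \<tau>"
  then obtain i where i: "i \<in> {1..<n}" "\<sigma> i < \<sigma> (Suc i)"
    "coinversions n (\<sigma> \<circ> adj i) \<subseteq> coinversions n \<tau>"
    using upper_cover_exists[OF \<sigma> \<tau>] eq by (metis subset_refl)
  then show False
    using coinversions_comp_adj[OF \<sigma> i(1,2)] eq by auto
qed

section \<open>The weak order is a lattice\<close>

lemma weak_order_simps [simp]:
  "carrier (weak_order n) = {\<tau>. \<tau> permutes {1..n}}"
  "le (weak_order n) = (\<lambda>\<tau> \<tau>'. coinversions n \<tau> \<subseteq> coinversions n \<tau>')"
  "eq (weak_order n) = (=)"
  by (simp_all add: weak_order_def)

lemma partial_order_weak_order: "partial_order (weak_order n)"
  by unfold_locales (auto intro: coinversions_inject)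

lemma lattice_weak_order: "lattice (weak_order n)"
proof -
  interpret partial_order "weak_order n" by (rule partial_order_weak_order)
  show ?thesis
  proof unfold_locales
    fix \<sigma> \<tau> assume "\<sigma> \<in> carrier (weak_order n)" "\<tau> \<in> carrier (weak_order n)"
    then have perm: "\<sigma> permutes {1..n}" "\<tau> permutes {1..n}" by auto
    \<comment> \<open>Every upper bound has a transitive coinversion set containing both given ones,
      hence containing their transitive closure. As this closure is biclosed, it is the coinversion
      set of the join.\<close>
    let ?J = "(coinversions n \<sigma> \<union> coinversions n \<tau>)\<^sup>+"
    obtain \<rho> where \<rho>: "\<rho> permutes {1..n}" "coinversions n \<rho> = ?J"
      using biclosed_is_coinversions[OF biclosed_trancl_Un[OF biclosed_coinversions
          biclosed_coinversions]] .
    have "?J \<subseteq> coinversions n \<upsilon>"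
      if "coinversions n \<sigma> \<subseteq> coinversions n \<upsilon>" "coinversions n \<tau> \<subseteq> coinversions n \<upsilon>" for \<upsilon>
    proof -
      have "?J \<subseteq> (coinversions n \<upsilon>)\<^sup>+"
        using that by (intro trancl_mono_subset) auto
      then show ?thesis
        using biclosed_coinversions[of n \<upsilon>] by (simp add: biclosed_def trancl_id)
    qed
    then show "\<exists>s. least (weak_order n) s (Upper (weak_order n) {\<sigma>, \<tau>})"
      using \<rho> perm by (intro exI[of _ \<rho>]) (auto simp: least_def Upper_def)
    \<comment> \<open>The meet is the join construction carried out on complements.\<close>
    let ?K = "((pairs n - coinversions n \<sigma>) \<union> (pairs n - coinversions n \<tau>))\<^sup>+"
    obtain \<mu> where \<mu>: "\<mu> permutes {1..n}" "coinversions n \<mu> = pairs n - ?K"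
      using biclosed_is_coinversions[OF biclosed_complement[OF biclosed_trancl_Un[OF
          biclosed_complement[OF biclosed_coinversions]
          biclosed_complement[OF biclosed_coinversions]]]] .
    have "coinversions n \<upsilon> \<subseteq> pairs n - ?K"
      if "coinversions n \<upsilon> \<subseteq> coinversions n \<sigma>" "coinversions n \<upsilon> \<subseteq> coinversions n \<tau>" for \<upsilon>
    proof -
      have "?K \<subseteq> (pairs n - coinversions n \<upsilon>)\<^sup>+"
        using that by (intro trancl_mono_subset) auto
      also have "\<dots> = pairs n - coinversions n \<upsilon>"
        using biclosed_complement[OF biclosed_coinversions[of n \<upsilon>]]
        by (simp add: biclosed_def trancl_id)
      finally show ?thesis
        using coinversions_subset by blast
    qed
    moreover have "pairs n - ?K \<subseteq> coinversions n \<sigma>" "pairs n - ?K \<subseteq> coinversions n \<tau>"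
      using r_into_trancl'[of _ "(pairs n - coinversions n \<sigma>) \<union> (pairs n - coinversions n \<tau>)"]
      by blast+
    ultimately show "\<exists>s. greatest (weak_order n) s (Lower (weak_order n) {\<sigma>, \<tau>})"
      using \<mu> perm by (intro exI[of _ \<mu>]) (auto simp: greatest_def Lower_def)
  qed
qed
section \<open>Contracted arcs\<close>

text \<open>Through \<open>min\<close> and \<open>max\<close> the condition belongs to the
  undirected edge between \<open>\<sigma>\<close> and \<open>\<sigma> \<circ> adj i\<close>, so the
  same notion serves upward and downward steps.\<close>

definition contracted :: "(nat \<Rightarrow> nat \<Rightarrow> nat set \<Rightarrow> bool) \<Rightarrow> (nat \<Rightarrow> nat) \<Rightarrow> nat \<Rightarrow> bool" where
  "contracted C \<sigma> i \<longleftrightarrow>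
     C (min (\<sigma> i) (\<sigma> (Suc i))) (max (\<sigma> i) (\<sigma> (Suc i))) (\<sigma> ` {1..<i})"

text \<open>With \<open>R\<close> being \<open>(<)\<close> the step goes up in the weak order, with \<open>(>)\<close> it goes down.\<close>

definition arc_step :: "(nat \<Rightarrow> nat \<Rightarrow> bool) \<Rightarrow> nat \<Rightarrow> (nat \<Rightarrow> nat \<Rightarrow> nat set \<Rightarrow> bool) \<Rightarrow>
    (nat \<Rightarrow> nat) \<Rightarrow> (nat \<Rightarrow> nat) \<Rightarrow> bool" where
  "arc_step R n C \<sigma> \<tau> \<longleftrightarrow> \<sigma> permutes {1..n} \<and>
     (\<exists>i\<in>{1..<n}. R (\<sigma> i) (\<sigma> (Suc i)) \<and> \<tau> = \<sigma> \<circ> adj i \<and> contracted C \<sigma> i)"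

abbreviation cover_step :: "(nat \<Rightarrow> nat \<Rightarrow> bool) \<Rightarrow> nat \<Rightarrow> (nat \<Rightarrow> nat) \<Rightarrow> (nat \<Rightarrow> nat) \<Rightarrow> bool" where
  "cover_step R n \<equiv> arc_step R n (\<lambda>_ _ _. True)"

lemma contracted_True [simp]: "contracted (\<lambda>_ _ _. True) \<sigma> i"
  by (simp add: contracted_def)

lemma arc_stepI:
  "\<sigma> permutes {1..n} \<Longrightarrow> i \<in> {1..<n} \<Longrightarrow> R (\<sigma> i) (\<sigma> (Suc i)) \<Longrightarrow> contracted C \<sigma> i \<Longrightarrow>
    arc_step R n C \<sigma> (\<sigma> \<circ> adj i)"
  unfolding arc_step_def by blast

lemma arc_step_cover: "arc_step R n C \<sigma> \<tau> \<Longrightarrow> cover_step R n \<sigma> \<tau>"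
  unfolding arc_step_def by auto

lemma arc_step_permutes:
  "arc_step R n C \<sigma> \<tau> \<Longrightarrow> \<sigma> permutes {1..n} \<and> \<tau> permutes {1..n}"
  unfolding arc_step_def using comp_adj_permutes by blast

lemma image_comp_adj_below:
  assumes "j \<le> i"
  shows "(\<sigma> \<circ> adj i) ` {1..<j} = \<sigma> ` {1..<j}"
  using assms by (intro image_cong) auto

lemma image_comp_adj_above:
  assumes "1 \<le> i" "Suc i < j"
  shows "(\<sigma> \<circ> adj i) ` {1..<j} = \<sigma> ` {1..<j}"
proof -
  have "adj i ` {1..<j} = {1..<j}"
    unfolding adj_def using assms by (intro transpose_image_eq) auto
  then show ?thesis
    by (metis image_comp)
qed

lemma contracted_comp_adj: "contracted C (\<sigma> \<circ> adj i) i \<longleftrightarrow> contracted C \<sigma> i"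
  unfolding contracted_def by (simp add: image_comp_adj_below min.commute max.commute)

text \<open>A swap away from positions \<open>j\<close> and \<open>Suc j\<close> fixes both entries
  there, and it permutes either the values in front of them or those behind.\<close>

lemma contracted_comp_adj_far:
  assumes "1 \<le> i" "Suc i < j \<or> Suc j < i"
  shows "contracted C (\<sigma> \<circ> adj i) j \<longleftrightarrow> contracted C \<sigma> j"
proof -
  have "(\<sigma> \<circ> adj i) ` {1..<j} = \<sigma> ` {1..<j}"
    using assms(2)
  proof
    assume "Suc i < j"
    then show ?thesis
      using assms(1) by (intro image_comp_adj_above)
  next
    assume "Suc j < i"
    then show ?thesis
      by (intro image_comp_adj_below) simp
  qed
  moreover have "(\<sigma> \<circ> adj i) j = \<sigma> j" "(\<sigma> \<circ> adj i) (Suc j) = \<sigma> (Suc j)"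
    using assms by auto
  ultimately show ?thesis
    unfolding contracted_def by simp
qed

text \<open>Swapping is an involution and preserves \<open>contracted\<close>, so a downward step is
  an upward step read backwards. Thereby a polygon lemma for arbitrary direction covers both
  orders.\<close>

lemma arc_step_converse:
  "arc_step (>) n C = (arc_step (<) n C)\<inverse>\<inverse>"
proof -
  have flip: "arc_step R' n C \<tau> \<sigma>"
    if "arc_step R n C \<sigma> \<tau>" and R: "\<And>a b. R a b \<Longrightarrow> R' b a" for R R' \<sigma> \<tau>
  proof -
    obtain i where i: "\<sigma> permutes {1..n}" "i \<in> {1..<n}" "R (\<sigma> i) (\<sigma> (Suc i))"
      "\<tau> = \<sigma> \<circ> adj i" "contracted C \<sigma> i"
      using \<open>arc_step R n C \<sigma> \<tau>\<close> unfolding arc_step_def by blast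
    then have "arc_step R' n C \<tau> (\<tau> \<circ> adj i)"
      by (intro arc_stepI) (auto simp: contracted_comp_adj R)
    then show ?thesis
      using i by simp
  qed
  show ?thesis
    by (intro ext iffI; unfold conversep_iff; erule flip) simp_all
qed

lemma cover_step_coinversions:
  assumes "cover_step (<) n \<sigma> \<tau>"
  shows "coinversions n \<sigma> \<subset> coinversions n \<tau>"
  using assms coinversions_comp_adj unfolding arc_step_def by blast

lemma cover_path_coinversions:
  "(cover_step (<) n)\<^sup>*\<^sup>* \<sigma> \<tau> \<Longrightarrow> coinversions n \<sigma> \<subseteq> coinversions n \<tau>"
  by (induction rule: rtranclp_induct) (use cover_step_coinversions in blast)+

section \<open>Arc families closed under forcing, and polygons of the weak order\<close>

text \<open>\<open>A\<close> tells on which side of the arc each intermediate value passes. The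
  axiom is closure under Reading's forcing order: a contracted arc forces all arcs containing it as
  a subarc. The interval is open, so the longer arc may pass \<open>a\<close> and \<open>c\<close>
  on either side.\<close>

locale arc_ideal =
  fixes C :: "nat \<Rightarrow> nat \<Rightarrow> nat set \<Rightarrow> bool"
  assumes extend: "C a c A \<Longrightarrow> a' \<le> a \<Longrightarrow> c \<le> c' \<Longrightarrow>
    A \<inter> {a<..<c} = A' \<inter> {a<..<c} \<Longrightarrow> C a' c' A'"
begin

text \<open>Let \<open>p\<close>, \<open>q\<close>, \<open>r\<close> be the three entries. A
  contracted arc between \<open>q\<close> and \<open>r\<close> forces the arc between
  \<open>p\<close> and \<open>r\<close> with \<open>q\<close> in front, and again the arc between
  \<open>q\<close> and \<open>r\<close>, because \<open>p\<close> lies outside the interval from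
  \<open>q\<close> to \<open>r\<close>. Symmetrically, the arc between \<open>p\<close> and
  \<open>q\<close> forces the remaining edges on the opposite side of the hexagon.\<close>

lemma contracted_hexagon:
  assumes i: "1 \<le> i"
    and R: "R = (<) \<or> R = (>)" and desc: "R (\<sigma> i) (\<sigma> (Suc i))" "R (\<sigma> (Suc i)) (\<sigma> (Suc (Suc i)))"
  shows "contracted C \<sigma> (Suc i) \<Longrightarrow> contracted C (\<sigma> \<circ> adj i) (Suc i)"
    and "contracted C \<sigma> (Suc i) \<Longrightarrow> contracted C (\<sigma> \<circ> adj i \<circ> adj (Suc i)) i"
    and "contracted C \<sigma> i \<Longrightarrow> contracted C (\<sigma> \<circ> adj (Suc i)) i"
    and "contracted C \<sigma> i \<Longrightarrow> contracted C (\<sigma> \<circ> adj (Suc i) \<circ> adj i) (Suc i)"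
proof -
  \<comment> \<open>Arcs at position \<open>Suc i\<close> have one more entry in front than arcs at
    \<open>i\<close>. In each case this entry lies outside the open interval of the contracted
    arc.\<close>
  have ins: "{1..<Suc i} = insert i {1..<i}"
    using i by auto
  have im: "(\<lambda>x. \<sigma> (adj i x)) ` {Suc 0..<i} = \<sigma> ` {Suc 0..<i}"
    "(\<lambda>x. \<sigma> (adj (Suc i) x)) ` {Suc 0..<i} = \<sigma> ` {Suc 0..<i}"
    "(\<lambda>x. \<sigma> (adj i (adj (Suc i) x))) ` {Suc 0..<i} = \<sigma> ` {Suc 0..<i}"
    "(\<lambda>x. \<sigma> (adj (Suc i) (adj i x))) ` {Suc 0..<i} = \<sigma> ` {Suc 0..<i}"
    by (intro image_cong; simp)+
  show "contracted C \<sigma> (Suc i) \<Longrightarrow> contracted C (\<sigma> \<circ> adj i) (Suc i)"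
    "contracted C \<sigma> (Suc i) \<Longrightarrow> contracted C (\<sigma> \<circ> adj i \<circ> adj (Suc i)) i"
    "contracted C \<sigma> i \<Longrightarrow> contracted C (\<sigma> \<circ> adj (Suc i)) i"
    "contracted C \<sigma> i \<Longrightarrow> contracted C (\<sigma> \<circ> adj (Suc i) \<circ> adj i) (Suc i)"
    using R desc unfolding contracted_def ins
    by (auto simp: im elim!: extend)
qed

text \<open>Two swaps applied to \<open>z\<close> either commute, giving a square, or meet in three
  consecutive positions, giving a hexagon. The side through \<open>x\<close> is contracted by
  forcing; for the side through \<open>y\<close> plain covers suffice.\<close>

lemma arc_step_polygon:
  assumes R: "R = (<) \<or> R = (>)"
    and x: "cover_step R n z x" and y: "arc_step R n C z y" and "x \<noteq> y"
  obtains w where "(arc_step R n C)\<^sup>*\<^sup>* x w" "(cover_step R n)\<^sup>*\<^sup>* y w"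
proof -
  have trans: "R a b \<Longrightarrow> R b c \<Longrightarrow> R a c" for a b c
    using R by auto
  obtain i where i: "z permutes {1..n}" "i \<in> {1..<n}" "R (z i) (z (Suc i))" "x = z \<circ> adj i"
    using x unfolding arc_step_def by blast
  obtain j where j: "j \<in> {1..<n}" "R (z j) (z (Suc j))" "y = z \<circ> adj j" "contracted C z j"
    using y unfolding arc_step_def by blast
  have "i \<noteq> j"
    using \<open>x \<noteq> y\<close> i j by blast
  then consider (far) "Suc i < j \<or> Suc j < i" | (right) "j = Suc i" | (left) "i = Suc j"
    using \<open>i \<noteq> j\<close> by linarith
  then show thesis
  proof cases
    case far
    have "z \<circ> adj j \<circ> adj i = z \<circ> adj i \<circ> adj j"
      using far by (auto simp: fun_eq_iff adj_def Transposition.transpose_def)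
    moreover have "arc_step R n C (z \<circ> adj i) (z \<circ> adj i \<circ> adj j)"
      using far i j by (intro arc_stepI) (auto simp: contracted_comp_adj_far)
    moreover have "cover_step R n (z \<circ> adj j) (z \<circ> adj j \<circ> adj i)"
      using far i j by (intro arc_stepI) auto
    ultimately show ?thesis
      using that[of "z \<circ> adj i \<circ> adj j"] i j by auto
  next
    case right
    have R3: "R (z i) (z (Suc (Suc i)))"
      using trans i j right by blast
    have i1: "1 \<le> i"
      using i by auto
    note hex = contracted_hexagon[OF i1 R i(3) j(2)[unfolded right]]
    \<comment> \<open>By the braid relation both sides of the hexagon end in the same
      permutation.\<close>
    have "z \<circ> adj j \<circ> adj i \<circ> adj j = z \<circ> adj i \<circ> adj j \<circ> adj i"
      using right by (auto simp: fun_eq_iff adj_def Transposition.transpose_def)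
    moreover have "arc_step R n C (z \<circ> adj i) (z \<circ> adj i \<circ> adj j)"
      using right i j R3 hex by (intro arc_stepI) auto
    moreover have "arc_step R n C (z \<circ> adj i \<circ> adj j) (z \<circ> adj i \<circ> adj j \<circ> adj i)"
      using right i j R3 hex by (intro arc_stepI) auto
    moreover have "cover_step R n (z \<circ> adj j) (z \<circ> adj j \<circ> adj i)"
      using right i j R3 by (intro arc_stepI) auto
    moreover have "cover_step R n (z \<circ> adj j \<circ> adj i) (z \<circ> adj j \<circ> adj i \<circ> adj j)"
      using right i j R3 by (intro arc_stepI) auto
    ultimately show ?thesis
      using that[of "z \<circ> adj i \<circ> adj j \<circ> adj i"] i j
      by (metis (no_types, lifting) r_into_rtranclp rtranclp.rtrancl_into_rtrancl)
  next
    case left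
    \<comment> \<open>The same hexagon with the contracted swap now at its left pair of positions,
      so the other half of \<open>contracted_hexagon\<close> is used.\<close>
    have R3: "R (z j) (z (Suc (Suc j)))"
      using trans i j left by blast
    have j1: "1 \<le> j"
      using j by auto
    note hex = contracted_hexagon[OF j1 R j(2) i(3)[unfolded left]]
    have "z \<circ> adj j \<circ> adj i \<circ> adj j = z \<circ> adj i \<circ> adj j \<circ> adj i"
      using left by (auto simp: fun_eq_iff adj_def Transposition.transpose_def)
    moreover have "arc_step R n C (z \<circ> adj i) (z \<circ> adj i \<circ> adj j)"
      using left i j R3 hex by (intro arc_stepI) auto
    moreover have "arc_step R n C (z \<circ> adj i \<circ> adj j) (z \<circ> adj i \<circ> adj j \<circ> adj i)"
      using left i j R3 hex by (intro arc_stepI) auto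
    moreover have "cover_step R n (z \<circ> adj j) (z \<circ> adj j \<circ> adj i)"
      using left i j R3 by (intro arc_stepI) auto
    moreover have "cover_step R n (z \<circ> adj j \<circ> adj i) (z \<circ> adj j \<circ> adj i \<circ> adj j)"
      using left i j R3 by (intro arc_stepI) auto
    ultimately show ?thesis
      using that[of "z \<circ> adj i \<circ> adj j \<circ> adj i"] i j
      by (metis (no_types, lifting) r_into_rtranclp rtranclp.rtrancl_into_rtrancl)
  qed
qed

section \<open>The contraction axioms for the weak order and its dual\<close>

lemma lower_contraction_arc_step:
  "lower_contraction (carrier (weak_order n)) (le (weak_order n))
     (cover_step (<) n) (arc_step (<) n C) (\<lambda>\<sigma>. card (coinversions n \<sigma>))"
proof (unfold_locales; (unfold weak_order_simps mem_Collect_eq)?)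
  show "\<sigma> = \<tau>" if "\<sigma> permutes {1..n}" "\<tau> permutes {1..n}"
    "coinversions n \<sigma> \<subseteq> coinversions n \<tau>" "coinversions n \<tau> \<subseteq> coinversions n \<sigma>" for \<sigma> \<tau>
    using that coinversions_inject by (meson subset_antisym)
  show "cover_step (<) n \<sigma> \<tau>" if "arc_step (<) n C \<sigma> \<tau>" for \<sigma> \<tau>
    using that by (rule arc_step_cover)
  show "coinversions n \<sigma> \<subseteq> coinversions n \<tau>" if "cover_step (<) n \<sigma> \<tau>" for \<sigma> \<tau>
    using cover_step_coinversions[OF that] by (rule psubset_imp_subset)
  show "card (coinversions n \<sigma>) < card (coinversions n \<tau>)" if "cover_step (<) n \<sigma> \<tau>" for \<sigma> \<tau>
    by (rule psubset_card_mono[OF finite_coinversions cover_step_coinversions[OF that]])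
  show "\<exists>\<rho>. cover_step (<) n \<rho> \<tau> \<and> coinversions n \<sigma> \<subseteq> coinversions n \<rho>"
    if \<sigma>: "\<sigma> permutes {1..n}" and \<tau>: "\<tau> permutes {1..n}"
      and le: "coinversions n \<sigma> \<subseteq> coinversions n \<tau>" and "\<sigma> \<noteq> \<tau>" for \<sigma> \<tau>
  proof -
    obtain i where i: "i \<in> {1..<n}" "\<tau> (Suc i) < \<tau> i"
      "coinversions n \<sigma> \<subseteq> coinversions n (\<tau> \<circ> adj i)"
      using lower_cover_exists[OF \<sigma> \<tau> le \<open>\<sigma> \<noteq> \<tau>\<close>] .
    have "cover_step (>) n \<tau> (\<tau> \<circ> adj i)"
      using \<tau> i by (intro arc_stepI) simp_all
    then show ?thesis
      using i(3) unfolding arc_step_converse by blast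
  qed
  show "\<exists>w. (arc_step (<) n C)\<^sup>*\<^sup>* w x \<and> coinversions n w \<subseteq> coinversions n y"
    if "cover_step (<) n x z" "arc_step (<) n C y z" "x \<noteq> y" for x y z
  proof -
    \<comment> \<open>The polygon hangs below \<open>z\<close>, so the direction-independent lemma
      is used with \<open>(>)\<close>.\<close>
    have "cover_step (>) n z x" "arc_step (>) n C z y"
      using that unfolding arc_step_converse by simp_all
    then obtain w where "(arc_step (>) n C)\<^sup>*\<^sup>* x w" "(cover_step (>) n)\<^sup>*\<^sup>* y w"
      using arc_step_polygon[of "(>)"] \<open>x \<noteq> y\<close> by blast
    then show ?thesis
      using cover_path_coinversions unfolding arc_step_converse rtranclp_conversep by blast
  qed
qed (use arc_step_permutes in auto)

text \<open>In the dual order the rank must fall with every upward cover, so it counts the pairs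
  that are not coinversions. The polygon lemma is used with \<open>(<)\<close>.\<close>

lemma upper_contraction_arc_step:
  "lower_contraction (carrier (weak_order n)) (\<lambda>\<sigma> \<tau>. le (weak_order n) \<tau> \<sigma>)
     (cover_step (<) n)\<inverse>\<inverse> (arc_step (<) n C)\<inverse>\<inverse> (\<lambda>\<sigma>. card (pairs n - coinversions n \<sigma>))"
proof (unfold_locales; (unfold weak_order_simps mem_Collect_eq rtranclp_conversep)?;
    (unfold conversep_iff)?)
  show "\<sigma> = \<tau>" if "\<sigma> permutes {1..n}" "\<tau> permutes {1..n}"
    "coinversions n \<tau> \<subseteq> coinversions n \<sigma>" "coinversions n \<sigma> \<subseteq> coinversions n \<tau>" for \<sigma> \<tau>
    using that coinversions_inject by (meson subset_antisym)
  show "cover_step (<) n \<sigma> \<tau>" if "arc_step (<) n C \<sigma> \<tau>" for \<sigma> \<tau>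
    using that by (rule arc_step_cover)
  show "coinversions n \<sigma> \<subseteq> coinversions n \<tau>" if "cover_step (<) n \<sigma> \<tau>" for \<sigma> \<tau>
    using cover_step_coinversions[OF that] by (rule psubset_imp_subset)
  show "card (pairs n - coinversions n \<tau>) < card (pairs n - coinversions n \<sigma>)"
    if "cover_step (<) n \<sigma> \<tau>" for \<sigma> \<tau>
    using cover_step_coinversions[OF that] coinversions_subset[of n \<tau>]
    by (intro psubset_card_mono finite_Diff finite_pairs) blast
  show "\<exists>\<rho>. cover_step (<) n \<sigma> \<rho> \<and> coinversions n \<rho> \<subseteq> coinversions n \<tau>"
    if \<tau>: "\<tau> permutes {1..n}" and \<sigma>: "\<sigma> permutes {1..n}"
      and le: "coinversions n \<sigma> \<subseteq> coinversions n \<tau>" and "\<tau> \<noteq> \<sigma>" for \<sigma> \<tau>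
  proof -
    obtain i where i: "i \<in> {1..<n}" "\<sigma> i < \<sigma> (Suc i)"
      "coinversions n (\<sigma> \<circ> adj i) \<subseteq> coinversions n \<tau>"
      using upper_cover_exists[OF \<sigma> \<tau> le \<open>\<tau> \<noteq> \<sigma>\<close>[symmetric]] .
    have "cover_step (<) n \<sigma> (\<sigma> \<circ> adj i)"
      using \<sigma> i by (intro arc_stepI) simp_all
    then show ?thesis
      using i(3) by blast
  qed
  show "\<exists>w. (arc_step (<) n C)\<^sup>*\<^sup>* x w \<and> coinversions n y \<subseteq> coinversions n w"
    if steps: "cover_step (<) n z x" "arc_step (<) n C z y" "x \<noteq> y" for x y z
  proof -
    obtain w where "(arc_step (<) n C)\<^sup>*\<^sup>* x w" "(cover_step (<) n)\<^sup>*\<^sup>* y w"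
      using arc_step_polygon[OF disjI1[OF refl] steps] .
    then show ?thesis
      using cover_path_coinversions by blast
  qed
qed (use arc_step_permutes in auto)

theorem lattice_congruence_arc_step:
  "lattice_congruence (weak_order n)
     {(\<sigma>, \<tau>). \<sigma> permutes {1..n} \<and> \<tau> permutes {1..n} \<and> equivclp (arc_step (<) n C) \<sigma> \<tau>}"
  using lattice_congruence_of_contraction[OF lattice_weak_order lower_contraction_arc_step
      upper_contraction_arc_step]
  by simp

end

section \<open>Twists\<close>

text \<open>The negative values are counted in the complement of \<open>A\<close> instead of in the
  suffix \<open>V\<close>, so that the condition depends on the arc alone. The exchanged values
  \<open>a\<close> and \<open>c\<close> also lie in this complement, but outside the window from
  \<open>a'\<close> to \<open>c'\<close>.\<close>

definition twist_arc ::
  "nat \<Rightarrow> (nat \<Rightarrow> sign) \<Rightarrow> nat \<Rightarrow> nat \<Rightarrow> nat \<Rightarrow> nat set \<Rightarrow> bool" where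
  "twist_arc n \<epsilon> k a c A \<longleftrightarrow>
     (\<exists>a' c'. a < a' \<and> a' < c' \<and> c' < c \<and>
       (let p = int (card {w \<in> A. a' \<le> w \<and> w \<le> c' \<and> \<epsilon> w = Plus});
            m = int (card {w \<in> {1..n} - A. a' \<le> w \<and> w \<le> c' \<and> \<epsilon> w = Minus})
        in p - m \<ge> int k \<or> m - p \<ge> int k))"

text \<open>The same window \<open>a'\<close>, \<open>c'\<close> witnesses the condition for the
  longer arc: it lies strictly inside the shorter one, where \<open>A\<close> and \<open>A0\<close>
  agree, so both counts are unchanged.\<close>

lemma arc_ideal_twist_arc: "arc_ideal (twist_arc n \<epsilon> k)"
proof
  fix a c a0 c0 :: nat and A A0 :: "nat set"
  assume C: "twist_arc n \<epsilon> k a c A" and le: "a0 \<le> a" "c \<le> c0"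
    and AA: "A \<inter> {a<..<c} = A0 \<inter> {a<..<c}"
  have mem: "w \<in> A \<longleftrightarrow> w \<in> A0" if "a < w" "w < c" for w
    using AA that by (auto simp: set_eq_iff)
  obtain a' c' where a': "a < a'" "a' < c'" "c' < c" and
    count: "let p = int (card {w \<in> A. a' \<le> w \<and> w \<le> c' \<and> \<epsilon> w = Plus});
         m = int (card {w \<in> {1..n} - A. a' \<le> w \<and> w \<le> c' \<and> \<epsilon> w = Minus})
     in p - m \<ge> int k \<or> m - p \<ge> int k"
    using C unfolding twist_arc_def by blast
  have "{w \<in> A. a' \<le> w \<and> w \<le> c' \<and> \<epsilon> w = Plus} = {w \<in> A0. a' \<le> w \<and> w \<le> c' \<and> \<epsilon> w = Plus}"
    "{w \<in> {1..n} - A. a' \<le> w \<and> w \<le> c' \<and> \<epsilon> w = Minus} =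
     {w \<in> {1..n} - A0. a' \<le> w \<and> w \<le> c' \<and> \<epsilon> w = Minus}"
    using mem a' by auto
  then show "twist_arc n \<epsilon> k a0 c0 A0"
    unfolding twist_arc_def using a' le count
    by (intro exI[of _ a'] exI[of _ c']) simp
qed

lemma word_eq_append_iff:
  "word n \<sigma> = U @ [a, c] @ V \<longleftrightarrow>
    (\<exists>i\<in>{1..<n}. U = map \<sigma> [1..<i] \<and> a = \<sigma> i \<and> c = \<sigma> (Suc i) \<and>
       V = map \<sigma> [Suc (Suc i)..<Suc n])"
proof -
  have split: "word n \<sigma> = map \<sigma> [1..<i] @ [\<sigma> i, \<sigma> (Suc i)] @ map \<sigma> [Suc (Suc i)..<Suc n]"
    if "i \<in> {1..<n}" for i
  proof -
    have "[1..<Suc n] = [1..<i] @ [i..<Suc n]"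
      using that upt_add_eq_append[of 1 i "Suc n - i"] by simp
    also have "[i..<Suc n] = i # Suc i # [Suc (Suc i)..<Suc n]"
      using that by (simp add: upt_rec[of i] upt_rec[of "Suc i"])
    finally show ?thesis
      by (simp only: word_def) simp
  qed
  show ?thesis
  proof
    assume eq: "word n \<sigma> = U @ [a, c] @ V"
    have "length (word n \<sigma>) = n"
      by (simp add: word_def)
    then have "Suc (Suc (length U + length V)) = n"
      unfolding eq by simp
    \<comment> \<open>Positions start at \<open>1\<close>, so the letter after \<open>U\<close> has
      position \<open>Suc (length U)\<close>.\<close>
    then have i: "Suc (length U) \<in> {1..<n}"
      by auto
    show "\<exists>i\<in>{1..<n}. U = map \<sigma> [1..<i] \<and> a = \<sigma> i \<and> c = \<sigma> (Suc i) \<and>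
       V = map \<sigma> [Suc (Suc i)..<Suc n]"
      by (rule bexI[OF _ i]) (use split[OF i] eq in \<open>simp del: upt_Suc\<close>)
  next
    assume "\<exists>i\<in>{1..<n}. U = map \<sigma> [1..<i] \<and> a = \<sigma> i \<and> c = \<sigma> (Suc i) \<and>
       V = map \<sigma> [Suc (Suc i)..<Suc n]"
    then show "word n \<sigma> = U @ [a, c] @ V"
      using split by blast
  qed
qed

lemma word_inject:
  assumes "\<sigma> permutes {1..n}" "\<tau> permutes {1..n}" "word n \<sigma> = word n \<tau>"
  shows "\<sigma> = \<tau>"
proof
  fix x
  show "\<sigma> x = \<tau> x"
  proof (cases "x \<in> {1..n}")
    case True
    then show ?thesis
      using assms(3) unfolding word_def map_eq_conv by auto
  next
    case False
    then show ?thesis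
      using assms(1,2) by (simp add: permutes_not_in)
  qed
qed

text \<open>The suffix \<open>V\<close> consists of the values that are neither in \<open>U\<close>
  nor among the two exchanged ones, and the latter fall outside the window. So counting in
  \<open>V\<close> agrees with counting in the complement of \<open>U\<close>.\<close>

lemma twist_step_eq_arc_step: "twist_step n \<epsilon> k = arc_step (<) n (twist_arc n \<epsilon> k)"
proof (intro ext)
  fix \<sigma> \<tau>
  have swapped: "word n (\<sigma> \<circ> adj i) =
      map \<sigma> [1..<i] @ [\<sigma> (Suc i), \<sigma> i] @ map \<sigma> [Suc (Suc i)..<Suc n]"
    if "i \<in> {1..<n}" for i
    unfolding word_eq_append_iff using that by (intro bexI[of _ i]) (auto simp del: upt_Suc)
  have arc: "(\<exists>a' c'. \<sigma> i < a' \<and> a' < c' \<and> c' < \<sigma> (Suc i) \<and>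
       (int (sign_count \<epsilon> Plus a' c' (map \<sigma> [1..<i])) -
          int (sign_count \<epsilon> Minus a' c' (map \<sigma> [Suc (Suc i)..<Suc n])) \<ge> int k \<or>
        int (sign_count \<epsilon> Minus a' c' (map \<sigma> [Suc (Suc i)..<Suc n])) -
          int (sign_count \<epsilon> Plus a' c' (map \<sigma> [1..<i])) \<ge> int k)) \<longleftrightarrow>
      contracted (twist_arc n \<epsilon> k) \<sigma> i"
    if \<sigma>: "\<sigma> permutes {1..n}" and i: "i \<in> {1..<n}" and asc: "\<sigma> i < \<sigma> (Suc i)" for i
  proof -
    have "{1..n} = {1..<i} \<union> {i, Suc i} \<union> {Suc (Suc i)..<Suc n}"
      using i by auto
    then have "{1..n} = \<sigma> ` ({1..<i} \<union> {i, Suc i} \<union> {Suc (Suc i)..<Suc n})"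
      using permutes_image[OF \<sigma>] by metis
    then have un: "{1..n} = \<sigma> ` {1..<i} \<union> {\<sigma> i, \<sigma> (Suc i)} \<union> \<sigma> ` {Suc (Suc i)..<Suc n}"
      by (simp only: image_Un image_insert image_empty)
    have "{1..<i} \<inter> {Suc (Suc i)..<Suc n} = {}"
      by auto
    then have disj: "\<sigma> ` {1..<i} \<inter> \<sigma> ` {Suc (Suc i)..<Suc n} = {}"
      using image_Int[OF permutes_inj[OF \<sigma>]] by (metis image_empty)
    \<comment> \<open>Strictly between the exchanged values, standing behind them is the same as not
      standing in front.\<close>
    have mem: "w \<in> \<sigma> ` {Suc (Suc i)..<Suc n} \<longleftrightarrow> w \<in> {1..n} - \<sigma> ` {1..<i}"
      if "\<sigma> i < w" "w < \<sigma> (Suc i)" for w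
    proof -
      have "w \<noteq> \<sigma> i" "w \<noteq> \<sigma> (Suc i)"
        using that by auto
      then show ?thesis
        unfolding un using disj by blast
    qed
    have minus: "sign_count \<epsilon> Minus a' c' (map \<sigma> [Suc (Suc i)..<Suc n]) =
        card {w \<in> {1..n} - \<sigma> ` {1..<i}. a' \<le> w \<and> w \<le> c' \<and> \<epsilon> w = Minus}"
      if "\<sigma> i < a'" "c' < \<sigma> (Suc i)" for a' c'
    proof -
      have "w \<in> \<sigma> ` {Suc (Suc i)..<Suc n} \<and> a' \<le> w \<and> w \<le> c' \<and> \<epsilon> w = Minus \<longleftrightarrow>
          w \<in> {1..n} - \<sigma> ` {1..<i} \<and> a' \<le> w \<and> w \<le> c' \<and> \<epsilon> w = Minus" for w
        using mem[of w] that by (meson le_less_trans less_le_trans)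
      then show ?thesis
        unfolding sign_count_def set_map set_upt by presburger
    qed
    have plus: "sign_count \<epsilon> Plus a' c' (map \<sigma> [1..<i]) =
        card {w \<in> \<sigma> ` {1..<i}. a' \<le> w \<and> w \<le> c' \<and> \<epsilon> w = Plus}" for a' c'
      unfolding sign_count_def set_map set_upt ..
    have minmax: "min (\<sigma> i) (\<sigma> (Suc i)) = \<sigma> i" "max (\<sigma> i) (\<sigma> (Suc i)) = \<sigma> (Suc i)"
      using asc by auto
    show ?thesis
      unfolding contracted_def twist_arc_def minmax plus Let_def
      using minus by (metis (no_types, lifting))
  qed
  show "twist_step n \<epsilon> k \<sigma> \<tau> \<longleftrightarrow> arc_step (<) n (twist_arc n \<epsilon> k) \<sigma> \<tau>"
  proof
    assume "twist_step n \<epsilon> k \<sigma> \<tau>"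
    then obtain U a c V where perm: "\<sigma> permutes {1..n}" "\<tau> permutes {1..n}" and
      words: "word n \<sigma> = U @ [a, c] @ V" "word n \<tau> = U @ [c, a] @ V" and "a < c" and
      count: "\<exists>a' c'. a < a' \<and> a' < c' \<and> c' < c \<and>
           (int (sign_count \<epsilon> Plus a' c' U) - int (sign_count \<epsilon> Minus a' c' V) \<ge> int k \<or>
            int (sign_count \<epsilon> Minus a' c' V) - int (sign_count \<epsilon> Plus a' c' U) \<ge> int k)"
      unfolding twist_step_def by blast
    obtain i where i: "i \<in> {1..<n}" "U = map \<sigma> [1..<i]" "a = \<sigma> i" "c = \<sigma> (Suc i)"
      "V = map \<sigma> [Suc (Suc i)..<Suc n]"
      using words(1) unfolding word_eq_append_iff by blast
    \<comment> \<open>The rule prescribes only the word of \<open>\<tau>\<close>; a permutation of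
      \<open>1..n\<close> is recovered from its word, which identifies \<open>\<tau>\<close> with
      the swap.\<close>
    have "word n \<tau> = word n (\<sigma> \<circ> adj i)"
      unfolding words(2) swapped[OF i(1)] i(2-5) ..
    then have "\<tau> = \<sigma> \<circ> adj i"
      by (rule word_inject[OF perm(2) comp_adj_permutes[OF perm(1) i(1)]])
    then show "arc_step (<) n (twist_arc n \<epsilon> k) \<sigma> \<tau>"
      using i \<open>a < c\<close> count perm arc[of i] unfolding arc_step_def by blast
  next
    assume "arc_step (<) n (twist_arc n \<epsilon> k) \<sigma> \<tau>"
    then obtain i where i: "\<sigma> permutes {1..n}" "i \<in> {1..<n}" "\<sigma> i < \<sigma> (Suc i)"
      "\<tau> = \<sigma> \<circ> adj i" "contracted (twist_arc n \<epsilon> k) \<sigma> i"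
      unfolding arc_step_def by blast
    have "word n \<sigma> = map \<sigma> [1..<i] @ [\<sigma> i, \<sigma> (Suc i)] @ map \<sigma> [Suc (Suc i)..<Suc n]"
      unfolding word_eq_append_iff using i(2) by blast
    then show "twist_step n \<epsilon> k \<sigma> \<tau>"
      unfolding twist_step_def
      using i arc[OF i(1-3)] swapped[OF i(2)] comp_adj_permutes[OF i(1,2)] by blast
  qed
qed

theorem theorem110:
  fixes n k :: nat and \<epsilon> :: "nat \<Rightarrow> sign"
  shows "lattice_congruence (weak_order n) (twist_congruence n \<epsilon> k)"
  unfolding twist_congruence_def twist_step_eq_arc_step
  using arc_ideal.lattice_congruence_arc_step[OF arc_ideal_twist_arc] .

end
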